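(* Let $(z,w)$, $w=u+iv$, be the standard complex coordinates on $\mathbb{C}^2$ and let $g$ be the Kähler metric on $\mathbb{C}^2$ with coefficient matrix $$g=\begin{pmatrix}4e^u & 2\bar z e^u\\[0.5em] 2ze^u & |z|^2e^u+\frac14 e^{-u}\end{pmatrix}.$$ Let $p\in\mathbb{C}^2$. Then: (i) for all sufficiently small $r>0$ (depending on $p$), the volume with respect to $g$ of the geodesic ball $B_g(p,r)$ equals the volume of the Euclidean ball of radius $r$ in $\mathbb{C}^2=\mathbb{R}^4$; (ii) let $N=\{(Z,U+iV)\in T_p\mathbb{C}^2 : V=0,\ U>0\}$. For every tangent vector $\xi\in T_p\mathbb{C}^2\setminus N$ the geodesic of $g$ starting at $p$ with initial velocity $\xi$ is defined for all $t\ge 0$, and for every $r>0$ the set $$\{\exp_p(\xi) : \xi\in T_p\mathbb{C}^2\setminus N,\ g_p(\xi,\xi)\le r^2\}$$ has volume with respect to $g$ equal to the volume of the Euclidean ball of radius $r$ in $\mathbb{C}^2=\mathbb{R}^4$.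
   Context: The metric $g$ (Warren's metric) is the complex Hessian of $f(z,w)=4|z|^2e^{\operatorname{Re}(w)}+e^{-\operatorname{Re}(w)}$: its entries are $g_{\alpha\bar\beta}=\partial^2 f/\partial z_\alpha\partial\bar z_\beta$ with $(z_1,z_2)=(z,w)$. Tangent vectors at $p$ are identified with elements $\xi=(Z,W)\in\mathbb{C}^2$, $W=U+iV$, in the coordinates $(z,w)$, and $g_p(\xi,\xi)=\sum_{\alpha,\beta}g_{\alpha\bar\beta}(p)\xi_\alpha\bar\xi_\beta$; the associated Riemannian metric is $\operatorname{Re}\sum g_{\alpha\bar\beta}\xi_\alpha\bar\eta_\beta$, so that the standard Hermitian metric corresponds to the standard Euclidean metric on $\mathbb{R}^4$. The volume with respect to $g$ is the Riemannian volume of this metric. The map $\exp_p$ is the exponential map of $g$ at $p$ (time-one value of the geodesic with the given initial velocity, where defined), and for small $r$ the geodesic ball is $B_g(p,r)=\exp_p(\{\xi : g_p(\xi,\xi)<r^2\})$. *)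

theory Defs
  imports "HOL-Analysis.Analysis"
begin

text \<open>The real coordinates are \<open>(x, y, u, v)\<close>, where \<open>z = x + iy\<close> and \<open>w = u + iv\<close>.  A Riemannian
  metric is given as a function \<open>g\<close> with \<open>g p \<xi> \<eta>\<close> the inner product at \<open>p\<close> of \<open>\<xi>\<close> and \<open>\<eta>\<close>; tangent
  vectors are identified with elements of \<open>\<complex>\<^sup>2\<close>.\<close>

type_synonym c2 = "complex \<times> complex"
type_synonym metric = "c2 \<Rightarrow> c2 \<Rightarrow> c2 \<Rightarrow> real"

definition frame :: "4 \<Rightarrow> c2" where
  "frame i = (vector [(1, 0), (\<i>, 0), (0, 1), (0, \<i>)] :: c2 ^ 4) $ i"

definition gram :: "metric \<Rightarrow> c2 \<Rightarrow> real ^ 4 ^ 4" where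
  "gram g p = (\<chi> i j. g p (frame i) (frame j))"

definition riemannian_volume :: "metric \<Rightarrow> c2 measure" where
  "riemannian_volume g = density lebesgue (\<lambda>p. ennreal (sqrt (det (gram g p))))"

definition dgram :: "metric \<Rightarrow> c2 \<Rightarrow> 4 \<Rightarrow> 4 \<Rightarrow> 4 \<Rightarrow> real" where
  "dgram g p k i j = deriv (\<lambda>s. gram g (p + s *\<^sub>R frame k) $ i $ j) 0"

text \<open>\<open>christoffel g p k i j\<close> is the symbol of the second kind with upper index \<open>k\<close>.\<close>

definition christoffel :: "metric \<Rightarrow> c2 \<Rightarrow> 4 \<Rightarrow> 4 \<Rightarrow> 4 \<Rightarrow> real" where
  "christoffel g p k i j =
     (1/2) * (\<Sum>l\<in>UNIV. matrix_inv (gram g p) $ k $ l *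
       (dgram g p i j l + dgram g p j i l - dgram g p l i j))"

definition geodesic_acceleration :: "metric \<Rightarrow> c2 \<Rightarrow> c2 \<Rightarrow> c2" where
  "geodesic_acceleration g p \<xi> =
     - (\<Sum>k\<in>UNIV. (\<Sum>i\<in>UNIV. \<Sum>j\<in>UNIV.
          christoffel g p k i j * (\<xi> \<bullet> frame i) * (\<xi> \<bullet> frame j)) *\<^sub>R frame k)"

definition geodesic_on :: "metric \<Rightarrow> real set \<Rightarrow> (real \<Rightarrow> c2) \<Rightarrow> bool" where
  "geodesic_on g I \<gamma> \<longleftrightarrow>
     (\<exists>\<gamma>'. \<forall>t\<in>I. (\<gamma> has_vector_derivative \<gamma>' t) (at t within I) \<and>
       (\<gamma>' has_vector_derivative geodesic_acceleration g (\<gamma> t) (\<gamma>' t)) (at t within I))"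

definition geodesic_from :: "metric \<Rightarrow> c2 \<Rightarrow> c2 \<Rightarrow> real set \<Rightarrow> (real \<Rightarrow> c2) \<Rightarrow> bool" where
  "geodesic_from g p \<xi> I \<gamma> \<longleftrightarrow>
     geodesic_on g I \<gamma> \<and> \<gamma> 0 = p \<and> (\<gamma> has_vector_derivative \<xi>) (at 0 within I)"

definition exp_domain :: "metric \<Rightarrow> c2 \<Rightarrow> c2 set" where
  "exp_domain g p = {\<xi>. \<exists>\<gamma>. geodesic_from g p \<xi> {0..1} \<gamma>}"

text \<open>The value of \<open>exp_map g p \<xi>\<close> is meaningful only for \<open>\<xi> \<in> exp_domain g p\<close>.\<close>

definition exp_map :: "metric \<Rightarrow> c2 \<Rightarrow> c2 \<Rightarrow> c2" where
  "exp_map g p \<xi> = (THE q. \<exists>\<gamma>. geodesic_from g p \<xi> {0..1} \<gamma> \<and> \<gamma> 1 = q)"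

definition geodesic_ball :: "metric \<Rightarrow> c2 \<Rightarrow> real \<Rightarrow> c2 set" where
  "geodesic_ball g p r = exp_map g p ` {\<xi>. g p \<xi> \<xi> < r\<^sup>2}"

text \<open>Warren's metric: the entries are \<open>\<partial>\<^sup>2f / \<partial>z\<^sub>\<alpha> \<partial>cnj z\<^sub>\<beta>\<close> for
  \<open>f (z, w) = 4 * (cmod z)\<^sup>2 * exp (Re w) + exp (- Re w)\<close>.\<close>

definition warren_matrix :: "c2 \<Rightarrow> complex ^ 2 ^ 2" where
  "warren_matrix = (\<lambda>(z, w). let u = complex_of_real (Re w) in
     vector [vector [4 * exp u,         2 * cnj z * exp u],
             vector [2 * z * exp u,     (complex_of_real (cmod z))\<^sup>2 * exp u + 1/4 * exp (- u)]])"

text \<open>No factor 2 in front of the real part: the identity matrix yields the Euclidean inner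
  product of \<open>\<real>\<^sup>4\<close>.  As \<open>warren_matrix p\<close> is Hermitian, for \<open>\<eta> = \<xi>\<close> taking the real part changes
  nothing.\<close>

definition warren_metric :: metric where
  "warren_metric p \<xi> \<eta> =
     (let \<xi>' = (vector [fst \<xi>, snd \<xi>] :: complex ^ 2); \<eta>' = (vector [fst \<eta>, snd \<eta>] :: complex ^ 2)
      in Re (\<Sum>\<alpha>\<in>UNIV. \<Sum>\<beta>\<in>UNIV. warren_matrix p $ \<alpha> $ \<beta> * \<xi>' $ \<alpha> * cnj (\<eta>' $ \<beta>)))"

definition excluded_vectors :: "c2 set" where
  "excluded_vectors = {(Z, W). Im W = 0 \<and> Re W > 0}"

end

theory Submission
  imports Defs
begin

text \<open>The metric is flat: with \<open>\<zeta> = 2 z exp (w / 2)\<close> and \<open>\<eta> = exp (- w / 2)\<close> one has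
  \<open>g = \<bar>d\<zeta>\<bar>\<^sup>2 + \<bar>d\<eta>\<bar>\<^sup>2\<close>, so that \<open>(\<zeta>, \<eta>)\<close> is a local isometry onto \<open>\<complex> \<times> (\<complex> - {0})\<close> of Jacobian \<open>1\<close>.
  A geodesic is a lift of a straight line, with \<open>\<eta>\<close> proportional to \<open>1 - t W / 2\<close>; it breaks down
  only when \<open>\<eta>\<close> reaches \<open>0\<close>, i.e. when \<open>W\<close> is real and positive.  Off these directions
  \<open>w = w\<^sub>0 - 2 Ln (1 - t W / 2)\<close> with the principal branch, which makes \<open>exp\<^sub>p\<close> explicit, injective and
  volume preserving.\<close>

section \<open>Gram matrix, its determinant and its inverse\<close>

lemma det_4:
  "det (A::'a::comm_ring_1^4^4) =
    A$1$1 * (A$2$2 * (A$3$3 * A$4$4 - A$3$4 * A$4$3) - A$2$3 * (A$3$2 * A$4$4 - A$3$4 * A$4$2)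
      + A$2$4 * (A$3$2 * A$4$3 - A$3$3 * A$4$2))
  - A$1$2 * (A$2$1 * (A$3$3 * A$4$4 - A$3$4 * A$4$3) - A$2$3 * (A$3$1 * A$4$4 - A$3$4 * A$4$1)
      + A$2$4 * (A$3$1 * A$4$3 - A$3$3 * A$4$1))
  + A$1$3 * (A$2$1 * (A$3$2 * A$4$4 - A$3$4 * A$4$2) - A$2$2 * (A$3$1 * A$4$4 - A$3$4 * A$4$1)
      + A$2$4 * (A$3$1 * A$4$2 - A$3$2 * A$4$1))
  - A$1$4 * (A$2$1 * (A$3$2 * A$4$3 - A$3$3 * A$4$2) - A$2$2 * (A$3$1 * A$4$3 - A$3$3 * A$4$1)
      + A$2$3 * (A$3$1 * A$4$2 - A$3$2 * A$4$1))"
proof -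
  have f234: "finite {2::4, 3, 4}" "1 \<notin> {2::4, 3, 4}" by auto
  have f34: "finite {3::4, 4}" "2 \<notin> {3::4, 4}" by auto
  have f4: "finite {4::4}" "3 \<notin> {4::4}" by auto
  show ?thesis
    unfolding det_def UNIV_4
    unfolding sum_over_permutations_insert[OF f234]
    unfolding sum_over_permutations_insert[OF f34]
    unfolding sum_over_permutations_insert[OF f4]
    unfolding permutes_sing
    by (simp add: sign_swap_id permutation_swap_id sign_compose permutation_compose
        sign_id transpose_def algebra_simps)
qed

lemma vector_4:
  "(vector [a, b, c, d] :: ('a::zero)^4) $ 1 = a" "(vector [a, b, c, d] :: 'a^4) $ 2 = b"
  "(vector [a, b, c, d] :: 'a^4) $ 3 = c" "(vector [a, b, c, d] :: 'a^4) $ 4 = d"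
  by (simp_all add: vector_def)

lemma frame_simps [simp]:
  "frame 1 = (1, 0)" "frame 2 = (\<i>, 0)" "frame 3 = (0, 1)" "frame 4 = (0, \<i>)"
  by (simp_all add: frame_def vector_4)

text \<open>The summands are the polarisations of |d\<zeta>|^2 and |d\<eta>|^2, because d\<zeta> =
  exp (w/2) (2 dz + z dw) and d\<eta> = - exp (- w/2) dw / 2.\<close>

lemma warren_metric_eq:
  "warren_metric p \<xi> \<eta> =
     exp (Re (snd p)) * ((2 * fst \<xi> + fst p * snd \<xi>) \<bullet> (2 * fst \<eta> + fst p * snd \<eta>))
     + exp (- Re (snd p)) / 4 * (snd \<xi> \<bullet> snd \<eta>)"
proof -
  have [simp]: "cmod a * (cmod a * x) = Re a * (Re a * x) + Im a * (Im a * x)" for a x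
    using cmod_power2[of a] by (simp add: power2_eq_square flip: mult.assoc distrib_right)
  show ?thesis
    by (cases p) (simp add: warren_metric_def warren_matrix_def Let_def sum_2 inner_complex_def
      exp_of_real[symmetric] Re_exp Im_exp cmod_power2 algebra_simps power2_eq_square flip: of_real_minus)
qed

text \<open>\<open>E\<close> stands for exp u. Keeping it as a parameter makes all entries rational,
  so determinant and inverse become identities of field arithmetic.\<close>

definition warren_gram :: "complex \<Rightarrow> real \<Rightarrow> real ^ 4 ^ 4" where
  "warren_gram z E = vector
    [vector [4 * E, 0, 2 * Re z * E, - 2 * Im z * E],
     vector [0, 4 * E, 2 * Im z * E, 2 * Re z * E],
     vector [2 * Re z * E, 2 * Im z * E, ((Re z)\<^sup>2 + (Im z)\<^sup>2) * E + 1 / (4 * E), 0],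
     vector [- 2 * Im z * E, 2 * Re z * E, 0, ((Re z)\<^sup>2 + (Im z)\<^sup>2) * E + 1 / (4 * E)]]"

text \<open>An adjugate: the complex 2 by 2 matrix has determinant 1, so inversion swaps the
  diagonal blocks and negates the off-diagonal ones.\<close>

definition warren_gram_inv :: "complex \<Rightarrow> real \<Rightarrow> real ^ 4 ^ 4" where
  "warren_gram_inv z E = vector
    [vector [((Re z)\<^sup>2 + (Im z)\<^sup>2) * E + 1 / (4 * E), 0, - 2 * Re z * E, 2 * Im z * E],
     vector [0, ((Re z)\<^sup>2 + (Im z)\<^sup>2) * E + 1 / (4 * E), - 2 * Im z * E, - 2 * Re z * E],
     vector [- 2 * Re z * E, - 2 * Im z * E, 4 * E, 0],
     vector [2 * Im z * E, - 2 * Re z * E, 0, 4 * E]]"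

lemma gram_warren_metric: "gram warren_metric p = warren_gram (fst p) (exp (Re (snd p)))"
  by (simp add: vec_eq_iff forall_4 gram_def warren_gram_def vector_4 warren_metric_eq
      inner_complex_def exp_minus power2_eq_square divide_simps)

text \<open>The complex determinant is 4E (|z|^2 E + 1/(4E)) - |2zE|^2 = 1, and the real one is its
  square. Hence the Riemannian volume is Lebesgue measure.\<close>

lemma det_warren_gram: "E \<noteq> 0 \<Longrightarrow> det (warren_gram z E) = 1"
  by (simp add: det_4 warren_gram_def vector_4 field_simps power2_eq_square)

lemma warren_gram_inv:
  assumes "E \<noteq> 0"
  shows "matrix_inv (warren_gram z E) = warren_gram_inv z E"
proof -
  have *: "warren_gram z E ** warren_gram_inv z E = mat 1"
    using assms by (simp add: vec_eq_iff forall_4 matrix_matrix_mult_def sum_4 mat_def vector_4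
        warren_gram_def warren_gram_inv_def field_simps power2_eq_square)
  then have **: "warren_gram_inv z E ** warren_gram z E = mat 1"
    by (rule matrix_left_right_inverse[THEN iffD1])
  \<comment> \<open>\<open>matrix_inv\<close> is a Hilbert choice: its defining property is
    extracted first, and multiplication by the explicit inverse then identifies it.\<close>
  have "matrix_inv (warren_gram z E) ** warren_gram z E = mat 1"
    unfolding matrix_inv_def using * ** by (rule_tac someI2[of _ "warren_gram_inv z E"]) auto
  then have "matrix_inv (warren_gram z E) ** (warren_gram z E ** warren_gram_inv z E) = warren_gram_inv z E"
    by (simp add: matrix_mul_assoc)
  then show ?thesis by (simp add: *)
qed

lemma riemannian_volume_warren: "riemannian_volume warren_metric = lebesgue"
  by (simp add: riemannian_volume_def gram_warren_metric det_warren_gram density_1)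

section \<open>Derivatives of the metric and the geodesic equation\<close>

text \<open>The first index is the direction of differentiation. Along u, \<open>E\<close>
  differentiates to itself and 1/(4E) to its negative; the last slice is 0 because nothing depends
  on v.\<close>

definition warren_dgram :: "complex \<Rightarrow> real \<Rightarrow> real ^ 4 ^ 4 ^ 4" where
  "warren_dgram z E = vector
    [vector [vector [0, 0, 2 * E, 0], vector [0, 0, 0, 2 * E],
       vector [2 * E, 0, 2 * Re z * E, 0], vector [0, 2 * E, 0, 2 * Re z * E]],
     vector [vector [0, 0, 0, - 2 * E], vector [0, 0, 2 * E, 0],
       vector [0, 2 * E, 2 * Im z * E, 0], vector [- 2 * E, 0, 0, 2 * Im z * E]],
     vector [vector [4 * E, 0, 2 * Re z * E, - 2 * Im z * E],
       vector [0, 4 * E, 2 * Im z * E, 2 * Re z * E],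
       vector [2 * Re z * E, 2 * Im z * E, ((Re z)\<^sup>2 + (Im z)\<^sup>2) * E - 1 / (4 * E), 0],
       vector [- 2 * Im z * E, 2 * Re z * E, 0, ((Re z)\<^sup>2 + (Im z)\<^sup>2) * E - 1 / (4 * E)]],
     0]"

lemma dgram_warren:
  "dgram warren_metric p k i j = warren_dgram (fst p) (exp (Re (snd p))) $ k $ i $ j"
proof -
  have "\<forall>k i j. ((\<lambda>s. gram warren_metric (p + s *\<^sub>R frame k) $ i $ j) has_real_derivative
      warren_dgram (fst p) (exp (Re (snd p))) $ k $ i $ j) (at 0)"
    unfolding forall_4 gram_warren_metric warren_gram_def warren_dgram_def vector_4
    by (intro conjI; auto intro!: derivative_eq_intros simp: power2_eq_square field_simps)
  then show ?thesis
    unfolding dgram_def by (meson DERIV_imp_deriv)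
qed

text \<open>In flat coordinates this says \<eta>'' = 0, i.e. w'' = w'^2 / 2, and \<zeta>'' = 0,
  which then becomes z'' = - z' w' - z w'^2 / 2. The proof evaluates the Christoffel symbols
  directly.\<close>

lemma geodesic_acceleration_warren:
  "geodesic_acceleration warren_metric (z, w) (Z, W) = (- (Z * W) - z * W\<^sup>2 / 2, W\<^sup>2 / 2)"
proof -
  have [simp]: "exp (Re w) \<noteq> 0" by simp
  show ?thesis
    by (simp add: geodesic_acceleration_def christoffel_def gram_warren_metric warren_gram_inv dgram_warren
      sum_4 warren_gram_inv_def warren_dgram_def vector_4 prod_eq_iff complex_eq_iff
      inner_complex_def power2_eq_square field_simps)
qed

section \<open>Explicit geodesics, their uniqueness and the exponential map\<close>

text \<open>The lift of the line along which \<eta> is its initial value times 1 - tW/2 and \<zeta>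
  is affine; the first component is \<zeta>\<eta>/2. Since Ln 1 = 0, the principal branch starts at
  \<open>p\<close>.\<close>

definition warren_geodesic :: "c2 \<Rightarrow> c2 \<Rightarrow> real \<Rightarrow> c2" where
  "warren_geodesic p \<xi> t =
     ((fst p + of_real t * (fst \<xi> + fst p * snd \<xi> / 2)) * (1 - of_real t * snd \<xi> / 2),
      snd p - 2 * Ln (1 - of_real t * snd \<xi> / 2))"

lemma has_vector_derivative_field_chain:
  assumes "(s has_vector_derivative s') (at t within I)" "(f has_field_derivative f') (at (s t))"
  shows "((\<lambda>t. f (s t)) has_vector_derivative s' * f') (at t within I)"
  using field_vector_diff_chain_within[OF assms(1) has_field_derivative_at_within[OF assms(2)]]
  unfolding o_def .

text \<open>The hypothesis keeps 1 - tW/2 in the slit plane, where \<open>Ln\<close> is holomorphic,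
  so the explicit curve can be differentiated twice.\<close>

lemma geodesic_from_warren_geodesic:
  assumes nonpos: "\<And>t. t \<in> I \<Longrightarrow> 1 - of_real t * snd \<xi> / 2 \<notin> \<real>\<^sub>\<le>\<^sub>0" and "0 \<in> I"
  shows "geodesic_from warren_metric p \<xi> I (warren_geodesic p \<xi>)"
proof -
  obtain z w Z W where pq: "p = (z, w)" "\<xi> = (Z, W)" by (cases p; cases \<xi>)
  define B where "B = Z + z * W / 2"
  define s where "s = (\<lambda>t::real. 1 - of_real t * W / 2)"
  define \<gamma>' where "\<gamma>' = (\<lambda>t. (B * s t - (z + of_real t * B) * W / 2, W / s t))"
  have s: "s t \<notin> \<real>\<^sub>\<le>\<^sub>0" if "t \<in> I" for t using nonpos[OF that] by (simp add: s_def pq)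
  then have s0: "s t \<noteq> 0" if "t \<in> I" for t using that by force
  have ds: "(s has_vector_derivative - W / 2) (at t within I)" for t
    unfolding s_def by (auto intro!: derivative_eq_intros)
  have dl: "((\<lambda>t. z + of_real t * B) has_vector_derivative B) (at t within I)" for t
    by (auto intro!: derivative_eq_intros)
  have eq: "warren_geodesic p \<xi> = (\<lambda>t. ((z + of_real t * B) * s t, w - 2 * Ln (s t)))"
    by (simp add: fun_eq_iff warren_geodesic_def s_def B_def pq)
  have 1: "(warren_geodesic p \<xi> has_vector_derivative \<gamma>' t) (at t within I)" if "t \<in> I" for t
  proof -
    have "((\<lambda>t. Ln (s t)) has_vector_derivative (- W / 2) * inverse (s t)) (at t within I)"
      by (rule has_vector_derivative_field_chain[OF ds has_field_derivative_Ln[OF s[OF that]]])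
    then show ?thesis unfolding eq \<gamma>'_def
      by (intro has_vector_derivative_Pair)
         (auto intro!: derivative_eq_intros ds dl simp: field_simps)
  qed
  have 2: "(\<gamma>' has_vector_derivative geodesic_acceleration warren_metric (warren_geodesic p \<xi> t) (\<gamma>' t))
      (at t within I)" if "t \<in> I" for t
  proof -
    have "((\<lambda>t. inverse (s t)) has_vector_derivative (- W / 2) * (- (inverse (s t)^2))) (at t within I)"
      by (rule has_vector_derivative_field_chain[OF ds])
        (use s0[OF that] in \<open>auto simp: power2_eq_square intro!: derivative_eq_intros\<close>)
    then have inv: "((\<lambda>t. W / s t) has_vector_derivative (W / s t)\<^sup>2 / 2) (at t within I)"
      using s0[OF that] has_vector_derivative_mult_right[of "\<lambda>t. inverse (s t)" _ _ W]
      by (force simp: power2_eq_square field_simps)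
    have lin: "((\<lambda>t. B * s t - (z + of_real t * B) * W / 2) has_vector_derivative - (B * W)) (at t within I)"
      by (auto intro!: derivative_eq_intros ds dl simp: field_simps)
    \<comment> \<open>z is quadratic in t, so z'' is the constant -BW; the identity matches it with
      the first component of the acceleration.\<close>
    have "- (B * W) = - ((B * s t - (z + of_real t * B) * W / 2) * (W / s t)) -
        (z + of_real t * B) * s t * (W / s t)\<^sup>2 / 2"
      using s0[OF that] by (simp add: field_simps power2_eq_square)
    then show ?thesis
      unfolding \<gamma>'_def eq geodesic_acceleration_warren
      using has_vector_derivative_Pair[OF lin inv] by simp
  qed
  have "\<gamma>' 0 = \<xi>" "warren_geodesic p \<xi> 0 = p"
    by (simp_all add: \<gamma>'_def s_def B_def pq warren_geodesic_def)
  then show ?thesis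
    unfolding geodesic_from_def geodesic_on_def using 1 2 1[OF \<open>0 \<in> I\<close>] by auto
qed

text \<open>Needed for the definite description in \<open>exp_map\<close>. The velocities in the
  flat coordinates are first integrals of any solution, and integrating them determines the
  curve.\<close>

lemma geodesic_from_warren_unique:
  assumes geo: "geodesic_from warren_metric p \<xi> {0..1} \<gamma>"
    and nonpos: "\<And>t. t \<in> {0..1} \<Longrightarrow> 1 - of_real t * snd \<xi> / 2 \<notin> \<real>\<^sub>\<le>\<^sub>0"
    and "t \<in> {0..1}"
  shows "\<gamma> t = warren_geodesic p \<xi> t"
proof -
  obtain z0 w0 Z W where pq: "p = (z0, w0)" "\<xi> = (Z, W)" by (cases p; cases \<xi>)
  define s where "s = (\<lambda>t::real. 1 - of_real t * W / 2)"
  have s: "s t \<notin> \<real>\<^sub>\<le>\<^sub>0" if "t \<in> {0..1}" for t using nonpos[OF that] by (simp add: s_def pq)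
  then have sn0: "s t \<noteq> 0" if "t \<in> {0..1}" for t using that by force
  have ds: "(s has_vector_derivative - W / 2) (at t within {0..1})" for t
    unfolding s_def by (auto intro!: derivative_eq_intros)
  obtain \<gamma>' where \<gamma>': "\<And>t. t \<in> {0..1} \<Longrightarrow> (\<gamma> has_vector_derivative \<gamma>' t) (at t within {0..1})"
    and \<gamma>'': "\<And>t. t \<in> {0..1} \<Longrightarrow>
      (\<gamma>' has_vector_derivative geodesic_acceleration warren_metric (\<gamma> t) (\<gamma>' t)) (at t within {0..1})"
    using geo unfolding geodesic_from_def geodesic_on_def by blast
  have init: "\<gamma> 0 = (z0, w0)" using geo by (simp add: geodesic_from_def pq)
  \<comment> \<open>One-sided derivatives at 0 are unique, as 0 is a limit point of the interval; so
    the chosen velocity field starts at \<xi>.\<close>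
  have init': "\<gamma>' 0 = (Z, W)"
    using geo vector_derivative_unique_within[OF _ \<gamma>'[of 0], of \<xi>]
    by (auto simp: geodesic_from_def pq trivial_limit_within islimpt_Icc)
  define z w z' w' where "z = fst \<circ> \<gamma>" and "w = snd \<circ> \<gamma>" and "z' = fst \<circ> \<gamma>'" and "w' = snd \<circ> \<gamma>'"
  note defs = z_def w_def z'_def w'_def
  have dz: "(z has_vector_derivative z' t) (at t within {0..1})"
    and dw: "(w has_vector_derivative w' t) (at t within {0..1})"
    and dz': "(z' has_vector_derivative - (z' t * w' t) - z t * (w' t)\<^sup>2 / 2) (at t within {0..1})"
    and dw': "(w' has_vector_derivative (w' t)\<^sup>2 / 2) (at t within {0..1})"
    if "t \<in> {0..1}" for t
    using bounded_linear.has_vector_derivative[OF bounded_linear_fst \<gamma>'[OF that]]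
      bounded_linear.has_vector_derivative[OF bounded_linear_snd \<gamma>'[OF that]]
      bounded_linear.has_vector_derivative[OF bounded_linear_fst \<gamma>''[OF that]]
      bounded_linear.has_vector_derivative[OF bounded_linear_snd \<gamma>''[OF that]]
      geodesic_acceleration_warren[of "fst (\<gamma> t)" "snd (\<gamma> t)" "fst (\<gamma>' t)" "snd (\<gamma>' t)"]
    by (auto simp: defs o_def)
  have const: "f t = f 0" if "\<And>t. t \<in> {0..1} \<Longrightarrow> (f has_vector_derivative 0) (at t within {0..1})" "t \<in> {0..1}"
    for f :: "real \<Rightarrow> complex" and t
    using has_vector_derivative_zero_constant[of "{0..1}" f] that
    by (metis atLeastAtMost_iff convex_real_interval(5) order_refl zero_le_one)
  have dexp: "((\<lambda>t. exp (c * w t)) has_vector_derivative (c * w' t) * exp (c * w t)) (at t within {0..1})"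
    if "t \<in> {0..1}" for t c
    by (rule has_vector_derivative_field_chain[OF has_vector_derivative_mult_right[OF dw[OF that]] DERIV_exp])
  \<comment> \<open>\<open>1\<close> and \<open>3\<close> say that the velocity in the flat coordinates is constant.\<close>
  have 1: "exp (- 1/2 * w t) * w' t = exp (- 1/2 * w0) * W" if "t \<in> {0..1}" for t
  proof -
    have "((\<lambda>t. exp (- 1/2 * w t) * w' t) has_vector_derivative 0) (at t within {0..1})"
      if "t \<in> {0..1}" for t
      by (rule has_vector_derivative_eq_rhs[OF has_vector_derivative_mult[OF dexp[OF that] dw'[OF that]]])
        (simp add: algebra_simps power2_eq_square)
    from const[OF this that] show ?thesis
      using init init' by (simp add: w_def w'_def)
  qed
  \<comment> \<open>Integrating \<open>1\<close>: \<eta> is affine along every solution.\<close>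
  have 2: "exp (- 1/2 * w t) = exp (- 1/2 * w0) * s t" if "t \<in> {0..1}" for t
  proof -
    have "((\<lambda>t. exp (- 1/2 * w t) - exp (- 1/2 * w0) * s t) has_vector_derivative 0) (at t within {0..1})"
      if "t \<in> {0..1}" for t
      by (rule has_vector_derivative_eq_rhs[OF has_vector_derivative_diff
            [OF dexp[OF that] has_vector_derivative_mult_right[OF ds]]])
        (use 1[OF that] in \<open>simp add: algebra_simps\<close>)
    from const[OF this that] show ?thesis
      using init by (simp add: s_def w_def)
  qed
  have w's: "w' t * s t = W" if "t \<in> {0..1}" for t
    using 1[OF that] 2[OF that] by (simp add: algebra_simps)
  \<comment> \<open>\<open>2\<close> alone fixes w only modulo 4 pi i. The vanishing derivative of w
    + 2 Ln s selects the branch, as Ln (s 0) = 0.\<close>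
  have w: "w t = w0 - 2 * Ln (s t)" if "t \<in> {0..1}" for t
  proof -
    have "((\<lambda>t. w t + 2 * Ln (s t)) has_vector_derivative 0) (at t within {0..1})"
      if "t \<in> {0..1}" for t
    proof -
      have "((\<lambda>t. Ln (s t)) has_vector_derivative (- W / 2) * inverse (s t)) (at t within {0..1})"
        by (rule has_vector_derivative_field_chain[OF ds has_field_derivative_Ln[OF s[OF that]]])
      then show ?thesis
        by (intro has_vector_derivative_eq_rhs[OF has_vector_derivative_add
              [OF dw[OF that] has_vector_derivative_mult_right]])
          (use w's[OF that] sn0[OF that] in \<open>auto simp: field_simps\<close>)
    qed
    from const[OF this that] show ?thesis
      using init by (simp add: s_def w_def algebra_simps)
  qed
  define B where "B = Z + z0 * W / 2"
  have dl: "((\<lambda>t. z0 + of_real t * B) has_vector_derivative B) (at t within {0..1})" for t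
    by (auto intro!: derivative_eq_intros)
  have 3: "exp (1/2 * w t) * (z' t + z t * w' t / 2) = exp (1/2 * w0) * B" if "t \<in> {0..1}" for t
  proof -
    have "((\<lambda>t. exp (1/2 * w t) * (z' t + (z t * w' t) / 2)) has_vector_derivative 0) (at t within {0..1})"
      if "t \<in> {0..1}" for t
      by (rule has_vector_derivative_eq_rhs[OF has_vector_derivative_mult[OF dexp[OF that]
            has_vector_derivative_add[OF dz'[OF that] has_vector_derivative_divide
              [OF has_vector_derivative_mult[OF dz[OF that] dw'[OF that]]]]]])
        (simp add: field_simps power2_eq_square)
    from const[OF this that] show ?thesis
      using init init' by (simp add: defs B_def)
  qed
  \<comment> \<open>Integrating \<open>3\<close>: \<zeta> is affine as well.\<close>
  have 4: "exp (1/2 * w t) * z t = exp (1/2 * w0) * (z0 + of_real t * B)" if "t \<in> {0..1}" for t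
  proof -
    have "((\<lambda>t. exp (1/2 * w t) * z t - exp (1/2 * w0) * (z0 + of_real t * B)) has_vector_derivative 0) (at t within {0..1})"
      if "t \<in> {0..1}" for t
      by (rule has_vector_derivative_eq_rhs[OF has_vector_derivative_diff
            [OF has_vector_derivative_mult[OF dexp[OF that] dz[OF that]] has_vector_derivative_mult_right[OF dl]]])
        (use 3[OF that] in \<open>simp add: algebra_simps\<close>)
    from const[OF this that] show ?thesis
      using init by (simp add: defs)
  qed
  \<comment> \<open>Recover z as \<zeta>\<eta>/2 from \<open>2\<close> and \<open>4\<close>.\<close>
  have "z t = exp (- 1/2 * w t) * (exp (1/2 * w t) * z t)"
    by (simp add: mult.assoc[symmetric] mult_exp_exp)
  also have "\<dots> = exp (- 1/2 * w0) * exp (1/2 * w0) * s t * (z0 + of_real t * B)"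
    unfolding 2[OF assms(3)] 4[OF assms(3)] by simp
  also have "\<dots> = (z0 + of_real t * B) * s t"
    by (simp add: mult_exp_exp)
  finally show ?thesis
    using w[OF assms(3)] by (simp add: prod_eq_iff warren_geodesic_def pq s_def B_def defs)
qed

text \<open>The slit plane is star-shaped about 1, so a condition at the endpoint t = 1 covers the
  whole segment.\<close>

lemma one_minus_scaled_notin_nonpos:
  fixes W :: complex
  assumes "1 - W / 2 \<notin> \<real>\<^sub>\<le>\<^sub>0" "t \<in> {0..1}"
  shows "1 - of_real t * W / 2 \<notin> \<real>\<^sub>\<le>\<^sub>0"
proof
  assume *: "1 - of_real t * W / 2 \<in> \<real>\<^sub>\<le>\<^sub>0"
  then have "t \<noteq> 0" by (auto simp: complex_nonpos_Reals_iff)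
  with * assms(2) have "Im W = 0" "t * Re W \<ge> 2" by (auto simp: complex_nonpos_Reals_iff)
  moreover from this assms(2) have "Re W \<ge> 2"
    by (smt (verit) atLeastAtMost_iff mult_left_le_one_le mult_nonneg_nonpos)
  ultimately show False using assms(1) by (simp add: complex_nonpos_Reals_iff)
qed

text \<open>Existence and uniqueness on {0..1} together resolve the definite description; the
  formula is the explicit geodesic at time 1.\<close>

lemma exp_warren:
  assumes "1 - snd \<xi> / 2 \<notin> \<real>\<^sub>\<le>\<^sub>0"
  shows "\<xi> \<in> exp_domain warren_metric p"
    and "exp_map warren_metric p \<xi> =
      ((fst p + fst \<xi> + fst p * snd \<xi> / 2) * (1 - snd \<xi> / 2), snd p - 2 * Ln (1 - snd \<xi> / 2))"
proof -
  note nonpos = one_minus_scaled_notin_nonpos[OF assms]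
  have ex: "geodesic_from warren_metric p \<xi> {0..1} (warren_geodesic p \<xi>)"
    by (rule geodesic_from_warren_geodesic) (use nonpos in auto)
  then show "\<xi> \<in> exp_domain warren_metric p" by (auto simp: exp_domain_def)
  have "exp_map warren_metric p \<xi> = warren_geodesic p \<xi> 1"
    unfolding exp_map_def
  proof (rule the_equality)
    show "\<exists>\<gamma>. geodesic_from warren_metric p \<xi> {0..1} \<gamma> \<and> \<gamma> 1 = warren_geodesic p \<xi> 1"
      using ex by blast
    show "q = warren_geodesic p \<xi> 1" if "\<exists>\<gamma>. geodesic_from warren_metric p \<xi> {0..1} \<gamma> \<and> \<gamma> 1 = q" for q
      using that geodesic_from_warren_unique[OF _ nonpos, of p _ 1] by force
  qed
  then show "exp_map warren_metric p \<xi> =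
      ((fst p + fst \<xi> + fst p * snd \<xi> / 2) * (1 - snd \<xi> / 2), snd p - 2 * Ln (1 - snd \<xi> / 2))"
    by (simp add: warren_geodesic_def algebra_simps)
qed

section \<open>Lebesgue measure on pairs of complex numbers and on \<open>real ^ 4\<close>\<close>

text \<open>Change of variables uses determinants of matrices over \<open>real ^ 4\<close>; maps of
  pairs are conjugated by this identification.\<close>

definition c2_of_vec :: "real ^ 4 \<Rightarrow> c2" where
  "c2_of_vec x = (Complex (x $ 1) (x $ 2), Complex (x $ 3) (x $ 4))"

definition vec_of_c2 :: "c2 \<Rightarrow> real ^ 4" where
  "vec_of_c2 \<xi> = vector [Re (fst \<xi>), Im (fst \<xi>), Re (snd \<xi>), Im (snd \<xi>)]"

lemma c2_of_vec_inverse [simp]: "c2_of_vec (vec_of_c2 \<xi>) = \<xi>"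
  by (simp add: c2_of_vec_def vec_of_c2_def vector_4)

lemma vec_of_c2_inverse [simp]: "vec_of_c2 (c2_of_vec x) = x"
  by (simp add: c2_of_vec_def vec_of_c2_def vector_4 vec_eq_iff forall_4)

lemma linear_c2_of_vec: "linear c2_of_vec"
  by (rule linearI) (simp_all add: c2_of_vec_def complex_eq_iff)

lemma linear_vec_of_c2: "linear vec_of_c2"
  by (rule linearI) (simp_all add: vec_of_c2_def vector_4 vec_eq_iff forall_4)

text \<open>Lebesgue measure is determined by its values on boxes, and the preimage of a box is a
  box with the same side lengths.\<close>

lemma distr_c2_of_vec_lborel: "distr lborel borel c2_of_vec = lborel"
proof (rule lborel_eqI[symmetric])
  have [measurable]: "c2_of_vec \<in> borel \<rightarrow>\<^sub>M borel"
    by (intro borel_measurable_continuous_onI linear_continuous_on linear_conv_bounded_linear[THEN iffD1]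
        linear_c2_of_vec)
  fix l u :: c2 assume lu: "\<And>b. b \<in> Basis \<Longrightarrow> l \<bullet> b \<le> u \<bullet> b"
  have le: "Re (fst l) \<le> Re (fst u)" "Im (fst l) \<le> Im (fst u)" "Re (snd l) \<le> Re (snd u)" "Im (snd l) \<le> Im (snd u)"
    using lu[of "(1, 0)"] lu[of "(\<i>, 0)"] lu[of "(0, 1)"] lu[of "(0, \<i>)"]
    by (simp_all add: Basis_prod_def Basis_complex_def inner_complex_def inner_prod_def)
  have vim: "c2_of_vec -` box l u = box (vec_of_c2 l) (vec_of_c2 u)"
    by (auto simp: mem_box_cart forall_4 c2_of_vec_def vec_of_c2_def vector_4 mem_box
        Basis_prod_def Basis_complex_def inner_complex_def inner_prod_def)
  have range: "(Basis :: (real^4) set) = range (\<lambda>i. axis i 1)"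
    by (auto simp: Basis_vec_def)
  have B: "prod f (Basis :: (real^4) set) = (\<Prod>i\<in>UNIV. f (axis i 1))" for f :: "real^4 \<Rightarrow> real"
    unfolding range by (subst prod.reindex) (auto simp: inj_on_def axis_eq_axis)
  have B': "prod f (Basis :: c2 set) = f (1, 0) * f (\<i>, 0) * f (0, 1) * f (0, \<i>)" for f :: "c2 \<Rightarrow> real"
  proof -
    have Basis: "(Basis :: c2 set) = {(1, 0), (\<i>, 0), (0, 1), (0, \<i>)}"
      by (auto simp: Basis_prod_def Basis_complex_def)
    show ?thesis unfolding Basis by (simp add: mult_ac)
  qed
  have "emeasure (distr lborel borel c2_of_vec) (box l u) = emeasure lborel (box (vec_of_c2 l) (vec_of_c2 u))"
    by (subst emeasure_distr) (auto simp: vim)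
  also have "\<dots> = (\<Prod>b\<in>Basis. (vec_of_c2 u - vec_of_c2 l) \<bullet> b)"
  proof (rule emeasure_lborel_box)
    have "\<forall>i. vec_of_c2 l $ i \<le> vec_of_c2 u $ i"
      using le by (simp add: forall_4 vec_of_c2_def vector_4)
    then show "vec_of_c2 l \<bullet> b \<le> vec_of_c2 u \<bullet> b" if "b \<in> Basis" for b
      using that by (auto simp: range inner_axis)
  qed
  also have "\<dots> = (\<Prod>b\<in>Basis. (u - l) \<bullet> b)"
    unfolding B B' UNIV_4
    by (simp add: inner_axis vec_of_c2_def vector_4 inner_complex_def inner_prod_def mult_ac)
  finally show "emeasure (distr lborel borel c2_of_vec) (box l u) = (\<Prod>b\<in>Basis. (u - l) \<bullet> b)" .
qed simp

lemma c2_of_vec_measurable: "c2_of_vec \<in> lebesgue \<rightarrow>\<^sub>M lebesgue"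
  and distr_c2_of_vec_lebesgue: "distr lebesgue lebesgue c2_of_vec = lebesgue"
proof -
  have [measurable]: "c2_of_vec \<in> borel \<rightarrow>\<^sub>M borel"
    by (intro borel_measurable_continuous_onI linear_continuous_on linear_conv_bounded_linear[THEN iffD1]
        linear_c2_of_vec)
  have "distr lebesgue borel c2_of_vec = lborel"
    by (simp add: distr_completion distr_c2_of_vec_lborel)
  then have eq: "distr lebesgue lborel c2_of_vec = lborel"
    by (simp cong: distr_cong)
  show "c2_of_vec \<in> lebesgue \<rightarrow>\<^sub>M lebesgue"
    by (simp add: completion.measurable_completion2 eq measurable_completion)
  show "distr lebesgue lebesgue c2_of_vec = lebesgue"
    using completion.completion_distr_eq[of c2_of_vec lborel lborel] by (simp add: eq measurable_completion)
qed

lemma emeasure_lebesgue_vimage_c2_of_vec: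
  assumes "A \<in> sets lebesgue"
  shows "c2_of_vec -` A \<in> sets lebesgue" "emeasure lebesgue (c2_of_vec -` A) = emeasure lebesgue A"
proof -
  show "c2_of_vec -` A \<in> sets lebesgue"
    using measurable_sets[OF c2_of_vec_measurable assms] by simp
  show "emeasure lebesgue (c2_of_vec -` A) = emeasure lebesgue A"
    using emeasure_distr[OF c2_of_vec_measurable assms] by (simp add: distr_c2_of_vec_lebesgue)
qed

lemma vec_of_c2_image: "vec_of_c2 ` A = c2_of_vec -` A"
proof
  show "c2_of_vec -` A \<subseteq> vec_of_c2 ` A"
    by (metis image_eqI subsetI vec_of_c2_inverse vimageD)
qed auto

text \<open>Change of variables with Jacobian of modulus 1, applied to the conjugated map
  \<open>h\<close>. Finiteness lets real-valued measures and \<open>emeasure\<close> be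
  exchanged.\<close>

lemma emeasure_unimodular_image:
  fixes f :: "c2 \<Rightarrow> c2"
  assumes S: "S \<in> sets lebesgue" and fin: "emeasure lebesgue S < \<infinity>"
    and der: "\<And>x. x \<in> S \<Longrightarrow> (f has_derivative f' x) (at x within S)"
    and inj: "inj_on f S"
    and det: "\<And>x. x \<in> S \<Longrightarrow> \<bar>det (matrix (vec_of_c2 \<circ> f' x \<circ> c2_of_vec))\<bar> = 1"
  shows "emeasure lebesgue (f ` S) = emeasure lebesgue S"
proof -
  define h where "h = vec_of_c2 \<circ> f \<circ> c2_of_vec"
  let ?S = "vec_of_c2 ` S"
  have blJ: "bounded_linear c2_of_vec" and blK: "bounded_linear vec_of_c2"
    using linear_c2_of_vec linear_vec_of_c2 by (simp_all add: linear_conv_bounded_linear)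
  have im: "f ` S \<in> sets lebesgue"
    using der by (intro differentiable_image_in_sets_lebesgue[OF S])
      (auto simp: differentiable_on_def differentiable_def)
  have S': "?S \<in> sets lebesgue" "emeasure lebesgue ?S = emeasure lebesgue S"
    using emeasure_lebesgue_vimage_c2_of_vec[OF S] by (simp_all add: vec_of_c2_image)
  then have lm: "?S \<in> lmeasurable" using fin by (simp add: fmeasurable_def)
  have dh: "(h has_derivative (vec_of_c2 \<circ> f' (c2_of_vec x) \<circ> c2_of_vec)) (at x within ?S)" if "x \<in> ?S" for x
  proof -
    have x: "c2_of_vec x \<in> S" using that by auto
    have "c2_of_vec ` ?S = S" by (simp add: image_image)
    then have "((f \<circ> c2_of_vec) has_derivative (f' (c2_of_vec x) \<circ> c2_of_vec)) (at x within ?S)"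
      using der[OF x] bounded_linear_imp_has_derivative[OF blJ] by (intro diff_chain_within) auto
    from bounded_linear.has_derivative[OF blK this] show ?thesis
      by (simp add: h_def o_def)
  qed
  have injh: "inj_on h ?S"
    unfolding h_def inj_on_def by simp (metis inj c2_of_vec_inverse inj_onD)
  \<comment> \<open>The integrand is constantly 1 on the set, so its integral is the measure of the
    set.\<close>
  have "((\<lambda>x. \<bar>det (matrix (vec_of_c2 \<circ> f' (c2_of_vec x) \<circ> c2_of_vec))\<bar>) has_integral measure lebesgue ?S) ?S"
    by (rule has_integral_eq[of _ "\<lambda>x. 1"])
      (use lm det in \<open>auto simp: lmeasure_integral has_integral_iff lmeasurable_iff_integrable_on\<close>)
  then have "h ` ?S \<in> lmeasurable \<and> measure lebesgue (h ` ?S) = measure lebesgue ?S"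
    using has_measure_differentiable_image[OF S'(1) dh injh] by blast
  then have "emeasure lebesgue (h ` ?S) = emeasure lebesgue ?S"
    using lm by (simp add: emeasure_eq_measure2)
  moreover have "h ` ?S = c2_of_vec -` (f ` S)"
    by (simp add: h_def image_image flip: vec_of_c2_image)
  ultimately show ?thesis
    using emeasure_lebesgue_vimage_c2_of_vec(2)[OF im] S'(2) by simp
qed

section \<open>Volume preservation of the exponential map in a unitary frame\<close>

text \<open>The real determinant of a complex-linear map is the squared modulus of its complex
  determinant, here |ad|^2.\<close>

lemma det_complex_triangular:
  assumes "a * d = (1::complex)"
  shows "det (matrix (vec_of_c2 \<circ> (\<lambda>x. (a * fst x + b * snd x, d * snd x)) \<circ> c2_of_vec)) = 1"
proof -
  have *: "det (matrix (vec_of_c2 \<circ> (\<lambda>x. (a * fst x + b * snd x, d * snd x)) \<circ> c2_of_vec))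
     = (cmod a)\<^sup>2 * (cmod d)\<^sup>2"
    by (simp add: det_4 matrix_def vec_of_c2_def c2_of_vec_def vector_4 axis_def cmod_power2)
      (simp add: algebra_simps power2_eq_square)
  show ?thesis unfolding * power_mult_distrib[symmetric] norm_mult[symmetric] assms by simp
qed

text \<open>In the flat coordinates \<open>(2 z exp (w / 2), exp (- w / 2))\<close> the differential at \<open>p\<close> is, up to a
  unitary factor, \<open>(Z, W) \<mapsto> (R (2 Z + z W), W / (2 R))\<close> with \<open>R = exp (Re w / 2)\<close>; this is its inverse.\<close>

definition unitary_frame :: "c2 \<Rightarrow> c2 \<Rightarrow> c2" where
  "unitary_frame p x = (let R = of_real (exp (Re (snd p) / 2))
     in (fst x / (2 * R) - fst p * R * snd x, 2 * R * snd x))"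

text \<open>Turns balls of the metric in the tangent space at \<open>p\<close> into Euclidean
  balls.\<close>

lemma warren_metric_unitary_frame:
  "warren_metric p (unitary_frame p x) (unitary_frame p x) = (norm x)\<^sup>2"
proof -
  define R where "R = exp (Re (snd p) / 2)"
  have "R > 0" by (simp add: R_def)
  have E: "exp (Re (snd p)) = R\<^sup>2" "exp (- Re (snd p)) = 1 / R\<^sup>2"
    by (simp_all add: R_def exp_minus flip: exp_double) (simp add: inverse_eq_divide)
  have 1: "2 * fst (unitary_frame p x) + fst p * snd (unitary_frame p x) = (1 / R) *\<^sub>R fst x"
    using \<open>R > 0\<close> by (simp add: unitary_frame_def Let_def scaleR_conv_of_real field_simps flip: R_def)
  have 2: "snd (unitary_frame p x) = (2 * R) *\<^sub>R snd x"
    by (simp add: unitary_frame_def Let_def scaleR_conv_of_real flip: R_def)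
  show ?thesis
    using \<open>R > 0\<close> unfolding warren_metric_eq 1 unfolding 2 E
    by (simp add: norm_prod_def flip: power2_norm_eq_inner) (simp add: field_simps power2_eq_square)
qed

lemma unitary_frame_surj: "\<exists>x. \<xi> = unitary_frame p x"
proof -
  define R where "R = complex_of_real (exp (Re (snd p) / 2))"
  have "R \<noteq> 0" by (simp add: R_def)
  \<comment> \<open>The witness is the flat differential itself, of which the frame is the
    inverse.\<close>
  then have "\<xi> = unitary_frame p (R * (2 * fst \<xi> + fst p * snd \<xi>), snd \<xi> / (2 * R))"
    by (simp add: unitary_frame_def Let_def prod_eq_iff field_simps flip: R_def)
  then show ?thesis ..
qed

text \<open>The second component is only scaled by a positive real, so the excluded half-line keeps
  its form.\<close>

lemma unitary_frame_excluded_iff: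
  "unitary_frame p x \<in> excluded_vectors \<longleftrightarrow> Im (snd x) = 0 \<and> Re (snd x) > 0"
  by (simp add: unitary_frame_def Let_def excluded_vectors_def zero_less_mult_iff)

text \<open>In frame coordinates the exponential map is injective with complex triangular
  derivative, and its diagonal entries are reciprocal.\<close>

lemma emeasure_exp_map_warren_image:
  assumes S: "S \<in> sets lebesgue" and fin: "emeasure lebesgue S < \<infinity>"
    and nonpos: "\<And>x. x \<in> S \<Longrightarrow> 1 - snd (unitary_frame p x) / 2 \<notin> \<real>\<^sub>\<le>\<^sub>0"
  shows "emeasure (riemannian_volume warren_metric) (exp_map warren_metric p ` unitary_frame p ` S)
    = emeasure lebesgue S"
proof -
  define R where "R = complex_of_real (exp (Re (snd p) / 2))"
  have R: "R \<noteq> 0" by (simp add: R_def)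
  \<comment> \<open>The formula for the exponential map after substituting the frame: W/2 = R x_2,
    and the terms z R x_2 in Z + zW/2 cancel.\<close>
  define F where "F = (\<lambda>x :: c2. ((fst p + fst x / (2 * R)) * (1 - R * snd x), snd p - 2 * Ln (1 - R * snd x)))"
  have half: "snd (unitary_frame p x) / 2 = R * snd x" for x
    by (simp add: unitary_frame_def Let_def R_def)
  have np: "1 - R * snd x \<notin> \<real>\<^sub>\<le>\<^sub>0" if "x \<in> S" for x
    using nonpos[OF that] unfolding half .
  have n0: "1 - R * snd x \<noteq> 0" if "x \<in> S" for x
    using np[OF that] by (metis nonpos_Reals_zero_I)
  have F: "exp_map warren_metric p (unitary_frame p x) = F x" if "x \<in> S" for x
    unfolding exp_warren(2)[OF nonpos[OF that]]
    by (simp add: F_def unitary_frame_def Let_def flip: R_def)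
  have "emeasure lebesgue (F ` S) = emeasure lebesgue S"
  proof (rule emeasure_unimodular_image[OF S fin])
    define a b d where "a x = (1 - R * snd x) / (2 * R)"
      and "b x = - (fst p + fst x / (2 * R)) * R"
      and "d x = 2 * R / (1 - R * snd x)" for x :: c2
    show "(F has_derivative (\<lambda>h. (a x * fst h + b x * snd h, d x * snd h))) (at x within S)"
      if "x \<in> S" for x
    proof -
      have "((\<lambda>x. 1 - R * snd x) has_derivative (\<lambda>h. - (R * snd h))) (at x within S)"
        by (auto intro!: derivative_eq_intros)
      from has_derivative_compose[OF this has_field_derivative_Ln[OF np[OF that], unfolded has_field_derivative_def]]
      have "((\<lambda>x. Ln (1 - R * snd x)) has_derivative (\<lambda>h. inverse (1 - R * snd x) * - (R * snd h))) (at x within S)"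
        by simp
      then have 2: "((\<lambda>x. snd p - 2 * Ln (1 - R * snd x)) has_derivative (\<lambda>h. d x * snd h)) (at x within S)"
        by (auto intro!: derivative_eq_intros simp: d_def field_simps)
      have 1: "((\<lambda>x. (fst p + fst x / (2 * R)) * (1 - R * snd x)) has_derivative
          (\<lambda>h. a x * fst h + b x * snd h)) (at x within S)"
        using R by (auto intro!: derivative_eq_intros simp: a_def b_def fun_eq_iff field_simps)
      show ?thesis
        unfolding F_def by (rule has_derivative_Pair[OF 1 2])
    qed
    show "inj_on F S"
    proof (rule inj_onI)
      fix x y assume xy: "x \<in> S" "y \<in> S" "F x = F y"
      then have "Ln (1 - R * snd x) = Ln (1 - R * snd y)"
        by (simp add: F_def)
      \<comment> \<open>\<open>Ln\<close> is injective on nonzero arguments, which recovers the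
        second coordinate; dividing by the nonzero common factor then recovers the first.\<close>
      then have "1 - R * snd x = 1 - R * snd y"
        by (simp only: Ln_eq_iff[OF n0[OF xy(1)] n0[OF xy(2)]])
      with xy n0[OF xy(1)] R show "x = y"
        by (simp add: F_def prod_eq_iff)
    qed
    show "\<bar>det (matrix (vec_of_c2 \<circ> (\<lambda>h. (a x * fst h + b x * snd h, d x * snd h)) \<circ> c2_of_vec))\<bar> = 1"
      if "x \<in> S" for x
      by (subst det_complex_triangular) (use R n0[OF that] in \<open>auto simp: a_def d_def\<close>)
  qed
  then show ?thesis
    using F by (simp add: image_image riemannian_volume_warren cong: image_cong)
qed

section \<open>Rays avoiding the branch cut, and the volume statements\<close>

text \<open>The ray 1 - tW/2 starts at 1 and meets the cut only if W is real and positive.\<close>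

lemma notin_excluded_vectors_notin_nonpos:
  assumes "\<xi> \<notin> excluded_vectors" "t \<ge> 0"
  shows "1 - of_real t * snd \<xi> / 2 \<notin> \<real>\<^sub>\<le>\<^sub>0"
proof
  assume "1 - of_real t * snd \<xi> / 2 \<in> \<real>\<^sub>\<le>\<^sub>0"
  then have *: "t * Re (snd \<xi>) \<ge> 2" "t * Im (snd \<xi>) = 0"
    by (simp_all add: complex_nonpos_Reals_iff)
  then have "t \<noteq> 0" by auto
  with * assms(2) have "Re (snd \<xi>) > 0" "Im (snd \<xi>) = 0"
    by (auto simp: zero_less_mult_iff dest!: less_le_trans[of 0 2, rotated])
  with assms(1) show False by (auto simp: excluded_vectors_def split: prod.splits)
qed

theorem mainTheorem3:
  fixes p :: "complex \<times> complex"
  shows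
    "(\<forall>\<^sub>F r in at_right (0::real).
        {\<xi>. warren_metric p \<xi> \<xi> < r\<^sup>2} \<subseteq> exp_domain warren_metric p \<and>
        emeasure (riemannian_volume warren_metric) (geodesic_ball warren_metric p r)
          = emeasure lborel (ball (0 :: complex \<times> complex) r)) \<and>
     (\<forall>\<xi>. \<xi> \<notin> excluded_vectors \<longrightarrow>
        (\<exists>\<gamma>. geodesic_from warren_metric p \<xi> {0..} \<gamma>)) \<and>
     (\<forall>r>0. emeasure (riemannian_volume warren_metric)
          {exp_map warren_metric p \<xi> | \<xi>. \<xi> \<notin> excluded_vectors \<and> warren_metric p \<xi> \<xi> \<le> r\<^sup>2}
        = emeasure lborel (ball (0 :: complex \<times> complex) r))"
proof (intro conjI allI impI)
  define R where "R = exp (Re (snd p) / 2)"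
  have "R > 0" by (simp add: R_def)
  \<comment> \<open>The threshold 1/R is |\<eta>| at \<open>p\<close>, the distance to the missing
    line \<eta> = 0. Below it Re (R x_2) < 1, so the cut is avoided.\<close>
  have "{\<xi>. warren_metric p \<xi> \<xi> < r\<^sup>2} \<subseteq> exp_domain warren_metric p \<and>
      emeasure (riemannian_volume warren_metric) (geodesic_ball warren_metric p r)
        = emeasure lborel (ball (0 :: c2) r)" if r: "0 < r" "r < 1 / R" for r
  proof -
    have eq: "{\<xi>. warren_metric p \<xi> \<xi> < r\<^sup>2} = unitary_frame p ` ball 0 r"
    proof (intro set_eqI iffI)
      fix \<xi> assume *: "\<xi> \<in> {\<xi>. warren_metric p \<xi> \<xi> < r\<^sup>2}"
      obtain x where x: "\<xi> = unitary_frame p x" using unitary_frame_surj by blast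
      with * r show "\<xi> \<in> unitary_frame p ` ball 0 r"
        by (auto simp: warren_metric_unitary_frame power2_less_imp_less)
    qed (auto simp: warren_metric_unitary_frame power_strict_mono)
    have np: "1 - snd (unitary_frame p x) / 2 \<notin> \<real>\<^sub>\<le>\<^sub>0" if "x \<in> ball 0 r" for x
    proof -
      have "R * Re (snd x) \<le> R * norm x"
        using \<open>R > 0\<close> complex_Re_le_cmod[of "snd x"] norm_snd_le[of "snd x" "fst x"] by (intro mult_left_mono) auto
      also have "\<dots> < R * (1 / R)"
        using that r \<open>R > 0\<close> by (intro mult_strict_left_mono) auto
      finally have "R * Re (snd x) < 1" using \<open>R > 0\<close> by simp
      then show ?thesis
        by (auto simp: complex_nonpos_Reals_iff unitary_frame_def Let_def simp flip: R_def)
    qed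
    show ?thesis
    proof
      show "{\<xi>. warren_metric p \<xi> \<xi> < r\<^sup>2} \<subseteq> exp_domain warren_metric p"
        unfolding eq using exp_warren(1)[OF np, of _ p] by blast
      have "emeasure lebesgue (ball (0::c2) r) < \<infinity>"
        using emeasure_lborel_ball_finite[of "0::c2" r] by simp
      from emeasure_exp_map_warren_image[OF _ this np]
      show "emeasure (riemannian_volume warren_metric) (geodesic_ball warren_metric p r)
        = emeasure lborel (ball (0 :: c2) r)"
        by (simp add: geodesic_ball_def eq)
    qed
  qed
  then show "\<forall>\<^sub>F r in at_right (0::real).
        {\<xi>. warren_metric p \<xi> \<xi> < r\<^sup>2} \<subseteq> exp_domain warren_metric p \<and>
        emeasure (riemannian_volume warren_metric) (geodesic_ball warren_metric p r)
          = emeasure lborel (ball (0 :: c2) r)"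
    using \<open>R > 0\<close> by (auto simp: eventually_at_right_field intro!: exI[of _ "1 / R"])
next
  fix \<xi> :: c2 assume "\<xi> \<notin> excluded_vectors"
  then have "geodesic_from warren_metric p \<xi> {0..} (warren_geodesic p \<xi>)"
    by (intro geodesic_from_warren_geodesic notin_excluded_vectors_notin_nonpos) auto
  then show "\<exists>\<gamma>. geodesic_from warren_metric p \<xi> {0..} \<gamma>" by blast
next
  fix r :: real assume r: "r > 0"
  define N :: "c2 set" where "N = {x. Im (snd x) = 0 \<and> Re (snd x) > 0}"
  have eq: "{\<xi>. \<xi> \<notin> excluded_vectors \<and> warren_metric p \<xi> \<xi> \<le> r\<^sup>2} = unitary_frame p ` (cball 0 r - N)"
  proof (intro set_eqI iffI)
    fix \<xi> assume *: "\<xi> \<in> {\<xi>. \<xi> \<notin> excluded_vectors \<and> warren_metric p \<xi> \<xi> \<le> r\<^sup>2}"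
    obtain x where x: "\<xi> = unitary_frame p x" using unitary_frame_surj by blast
    with * r show "\<xi> \<in> unitary_frame p ` (cball 0 r - N)"
      by (auto simp: warren_metric_unitary_frame N_def unitary_frame_excluded_iff intro!: imageI power2_le_imp_le)
  qed (auto simp: warren_metric_unitary_frame N_def unitary_frame_excluded_iff power_mono)
  \<comment> \<open>The excluded vectors lie in the real hyperplane V = 0, so removing them from the
    closed ball does not change its measure.\<close>
  have "negligible {x :: c2. (0, \<i>) \<bullet> x = 0}"
    by (rule negligible_hyperplane) (auto simp: prod_eq_iff)
  then have "negligible N"
    by (rule negligible_subset) (auto simp: N_def inner_prod_def inner_complex_def)
  then have N: "N \<in> null_sets lebesgue" by (simp add: negligible_iff_null_sets)
  have S: "cball 0 r - N \<in> sets lebesgue" using N by auto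
  have e: "emeasure lebesgue (cball 0 r - N) = emeasure lborel (ball (0::c2) r)"
    using r N by (simp add: emeasure_Diff_null_set emeasure_cball emeasure_ball)
  \<comment> \<open>The ray criterion at t = 1.\<close>
  have np: "1 - snd (unitary_frame p x) / 2 \<notin> \<real>\<^sub>\<le>\<^sub>0" if "x \<in> cball 0 r - N" for x
    using notin_excluded_vectors_notin_nonpos[of "unitary_frame p x" 1] that
    by (simp add: unitary_frame_excluded_iff N_def)
  have "emeasure lebesgue (cball 0 r - N) < \<infinity>"
    unfolding e by (rule emeasure_lborel_ball_finite)
  from emeasure_exp_map_warren_image[OF S this np]
  show "emeasure (riemannian_volume warren_metric)
          {exp_map warren_metric p \<xi> | \<xi>. \<xi> \<notin> excluded_vectors \<and> warren_metric p \<xi> \<xi> \<le> r\<^sup>2}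
        = emeasure lborel (ball (0 :: complex \<times> complex) r)"
    unfolding setcompr_eq_image eq e .
qed

end
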